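(* Let $\mathcal{X}=\bigcup_{\sigma\in\Sigma}\mathcal{X}_\sigma\subseteq\mathbb{R}^n$, where $\Sigma$ is a nonempty finite set and every $\mathcal{X}_\sigma$ is nonempty and compact. Let $B\in\mathbb{R}^{n\times r}$ and $Q=BB^{\mathsf T}$, and assume that the optimal value of $\max_{x\in\mathcal{X}}x^{\mathsf T}Qx$ is positive. Let $\mathcal{R}\subset\mathbb{R}^r$ be dense and let $\Sigma_{\mathcal{R}}\subseteq\Sigma$ be the set of regularly active structures. Then at least one global maximizer of $x^{\mathsf T}Qx$ over $\mathcal{X}$ belongs to $$\bigcup_{\sigma\in\Sigma_{\mathcal{R}}}\mathcal{X}_\sigma .$$ Consequently, if each restricted problem $\max_{x\in\mathcal{X}_\sigma}x^{\mathsf T}Qx$ can be solved exactly, solving it for all $\sigma\in\Sigma_{\mathcal{R}}$ and taking the best result solves $\max_{x\in\mathcal{X}}x^{\mathsf T}Qx$.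
   Context: Define $h_\sigma(z):=\max_{x\in\mathcal{X}_\sigma}\langle z,B^{\mathsf T}x\rangle$ and $h(z):=\max_{\sigma\in\Sigma}h_\sigma(z)$ for $z\in\mathbb{R}^r$. A structure $\sigma\in\Sigma$ is regularly active (with respect to $\mathcal{R}$) if $h_\sigma(z)=h(z)$ for some $z\in\mathcal{R}$. *)

theory Defs
  imports "HOL-Analysis.Analysis"
begin

text \<open>
  The maximum over a structure is written as a supremum of reals; it is attained whenever the
  set is nonempty and compact, so under those assumptions it is the maximum.
\<close>

definition h_struct :: "real ^ 'r ^ 'n \<Rightarrow> ('s \<Rightarrow> (real ^ 'n) set) \<Rightarrow> 's \<Rightarrow> real ^ 'r \<Rightarrow> real" where
  "h_struct B X \<sigma> z = (SUP x\<in>X \<sigma>. z \<bullet> (transpose B *v x))"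

definition h_max ::
    "real ^ 'r ^ 'n \<Rightarrow> 's set \<Rightarrow> ('s \<Rightarrow> (real ^ 'n) set) \<Rightarrow> real ^ 'r \<Rightarrow> real" where
  "h_max B \<Sigma> X z = Max ((\<lambda>\<sigma>. h_struct B X \<sigma> z) ` \<Sigma>)"

definition regularly_active ::
    "real ^ 'r ^ 'n \<Rightarrow> 's set \<Rightarrow> ('s \<Rightarrow> (real ^ 'n) set) \<Rightarrow> (real ^ 'r) set \<Rightarrow> 's \<Rightarrow> bool" where
  "regularly_active B \<Sigma> X R \<sigma> \<longleftrightarrow>
     \<sigma> \<in> \<Sigma> \<and> (\<exists>z\<in>R. h_struct B X \<sigma> z = h_max B \<Sigma> X z)"

definition quad_form :: "real ^ 'n ^ 'n \<Rightarrow> real ^ 'n \<Rightarrow> real" where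
  "quad_form Q x = x \<bullet> (Q *v x)"

end

theory Submission
  imports Defs
begin

text \<open>
  Let \<open>x*\<close> be a global maximizer and \<open>z* = B\<^sup>T x*\<close>, so that the optimal value is
  \<open>\<langle>z*, B\<^sup>T x*\<rangle> = norm z* ^ 2\<close>. The directions in which a fixed structure attains \<open>h\<close> form a
  closed set. The finitely many sets belonging to regularly active structures cover the dense
  set \<open>R\<close>, hence everything, and in particular \<open>z*\<close>. So some regularly active structure contains
  a point \<open>x\<close> with \<open>norm z* ^ 2 \<le> \<langle>z*, B\<^sup>T x\<rangle>\<close>, and by Cauchy--Schwarz
  \<open>norm z* \<le> norm (B\<^sup>T x)\<close>, i.e. \<open>x\<close> is a global maximizer too.
\<close>

text \<open>Moving \<open>B\<close> across the inner product turns comparison of objective values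
  into comparison of norms, the form in which Cauchy--Schwarz applies.\<close>

lemma quad_form_Gram: "quad_form (B ** transpose B) x = (norm (transpose B *v x))\<^sup>2"
  by (simp add: quad_form_def power2_norm_eq_inner dot_lmul_matrix[symmetric]
      matrix_vector_mul_assoc[symmetric] transpose_matrix_vector)

lemma continuous_on_quad_form: "continuous_on S (quad_form Q)"
  unfolding quad_form_def by (intro continuous_intros)

lemma norm_le_of_norm_sq_le_inner:
  fixes z w :: "'a::real_inner"
  assumes "(norm z)\<^sup>2 \<le> z \<bullet> w"
  shows "norm z \<le> norm w"
proof (cases "z = 0")
  case False
  have "norm z * norm z \<le> norm z * norm w"
    using assms norm_cauchy_schwarz[of z w] by (simp add: power2_eq_square)
  then show ?thesis
    using False by simp
qed simp

lemma h_struct_attained: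
  assumes "compact (X \<sigma>)" and "X \<sigma> \<noteq> {}"
  obtains x where "x \<in> X \<sigma>" and "h_struct B X \<sigma> z = z \<bullet> (transpose B *v x)"
proof -
  have "continuous_on (X \<sigma>) (\<lambda>x. z \<bullet> (transpose B *v x))"
    by (intro continuous_intros)
  then obtain x where x: "x \<in> X \<sigma>"
      "\<And>y. y \<in> X \<sigma> \<Longrightarrow> z \<bullet> (transpose B *v y) \<le> z \<bullet> (transpose B *v x)"
    using continuous_attains_sup[OF assms] by blast
  then have "h_struct B X \<sigma> z = z \<bullet> (transpose B *v x)"
    unfolding h_struct_def by (intro cSup_eq_maximum) auto
  with x that show thesis by blast
qed

lemma inner_le_h_struct:
  assumes "compact (X \<sigma>)" and "x \<in> X \<sigma>"
  shows "z \<bullet> (transpose B *v x) \<le> h_struct B X \<sigma> z"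
  unfolding h_struct_def
proof (rule cSUP_upper[OF assms(2)])
  have "continuous_on (X \<sigma>) (\<lambda>x. z \<bullet> (transpose B *v x))"
    by (intro continuous_intros)
  then show "bdd_above ((\<lambda>x. z \<bullet> (transpose B *v x)) ` X \<sigma>)"
    using assms(1) by (intro bounded_imp_bdd_above compact_imp_bounded compact_continuous_image)
qed

lemma inner_le_h_max:
  assumes "finite \<Sigma>" and "\<tau> \<in> \<Sigma>" and "compact (X \<tau>)" and "y \<in> X \<tau>"
  shows "z \<bullet> (transpose B *v y) \<le> h_max B \<Sigma> X z"
proof -
  have "z \<bullet> (transpose B *v y) \<le> h_struct B X \<tau> z"
    using assms(3,4) by (rule inner_le_h_struct)
  also have "\<dots> \<le> h_max B \<Sigma> X z"
    unfolding h_max_def using assms(1,2) by (intro Max_ge) auto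
  finally show ?thesis .
qed

text \<open>A maximum over a finite nonempty family is attained, and \<open>z\<close> itself
  witnesses regular activity.\<close>

lemma ex_regularly_active:
  assumes "finite \<Sigma>" and "\<Sigma> \<noteq> {}" and "z \<in> R"
  obtains \<sigma> where "regularly_active B \<Sigma> X R \<sigma>" and "h_struct B X \<sigma> z = h_max B \<Sigma> X z"
proof -
  have "h_max B \<Sigma> X z \<in> (\<lambda>\<sigma>. h_struct B X \<sigma> z) ` \<Sigma>"
    unfolding h_max_def using assms by (intro Max_in) auto
  with assms(3) that show thesis
    by (fastforce simp: regularly_active_def)
qed

lemma closed_dominating_directions:
  fixes S :: "(real ^ 'n) set" and B :: "real ^ 'r ^ 'n"
  assumes "compact S"
  shows "closed {z. \<forall>y\<in>Y. \<exists>x\<in>S. z \<bullet> (transpose B *v y) \<le> z \<bullet> (transpose B *v x)}"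
proof -
  have "closed {z. \<exists>x\<in>S. z \<bullet> (transpose B *v y) \<le> z \<bullet> (transpose B *v x)}" for y
  proof -
    \<comment> \<open>The point of \<open>S\<close> comes first in the pair, since
      \<open>closed_compact_projection\<close> projects away the first coordinate.\<close>
    let ?T = "{p :: (real ^ 'n) \<times> (real ^ 'r).
      snd p \<bullet> (transpose B *v y) \<le> snd p \<bullet> (transpose B *v fst p)}"
    have "closed ?T"
      by (intro closed_Collect_le continuous_intros
          bounded_linear.continuous_on[OF matrix_vector_mul_bounded_linear])
    from closed_compact_projection[OF assms this] show ?thesis
      by (simp add: Bex_def)
  qed
  then show ?thesis
    by (auto simp: Collect_ball_eq intro!: closed_INT)
qed

theorem theorem6p1:
  fixes \<Sigma> \<Sigma>R :: "'s set"
    and X :: "'s \<Rightarrow> (real ^ 'n) set"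
    and XX :: "(real ^ 'n) set"
    and B :: "real ^ 'r ^ 'n"
    and Q :: "real ^ 'n ^ 'n"
    and R :: "(real ^ 'r) set"
  assumes "finite \<Sigma>" and "\<Sigma> \<noteq> {}"
    and "\<And>\<sigma>. \<sigma> \<in> \<Sigma> \<Longrightarrow> X \<sigma> \<noteq> {}"
    and "\<And>\<sigma>. \<sigma> \<in> \<Sigma> \<Longrightarrow> compact (X \<sigma>)"
    and XX: "XX = (\<Union>\<sigma>\<in>\<Sigma>. X \<sigma>)"
    and Q: "Q = B ** transpose B"
    and pos: "(SUP x\<in>XX. quad_form Q x) > 0"
    and dense: "closure R = UNIV"
    and \<Sigma>R: "\<Sigma>R = {\<sigma> \<in> \<Sigma>. regularly_active B \<Sigma> X R \<sigma>}"
  shows "(\<exists>x. is_arg_max (quad_form Q) (\<lambda>x. x \<in> XX) x \<and> x \<in> (\<Union>\<sigma>\<in>\<Sigma>R. X \<sigma>)) \<and>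
    (\<forall>sol. (\<forall>\<sigma>\<in>\<Sigma>R. is_arg_max (quad_form Q) (\<lambda>x. x \<in> X \<sigma>) (sol \<sigma>)) \<longrightarrow>
       (\<exists>\<tau>. is_arg_max (\<lambda>\<sigma>. quad_form Q (sol \<sigma>)) (\<lambda>\<sigma>. \<sigma> \<in> \<Sigma>R) \<tau>) \<and>
       (\<forall>\<tau>. is_arg_max (\<lambda>\<sigma>. quad_form Q (sol \<sigma>)) (\<lambda>\<sigma>. \<sigma> \<in> \<Sigma>R) \<tau> \<longrightarrow>
            is_arg_max (quad_form Q) (\<lambda>x. x \<in> XX) (sol \<tau>)))"
proof -
  have finR: "finite \<Sigma>R" and subR: "\<Sigma>R \<subseteq> \<Sigma>"
    using \<open>finite \<Sigma>\<close> \<Sigma>R by auto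
  have "compact XX" and "XX \<noteq> {}"
    using assms(1-4) unfolding XX by (auto intro: compact_UN)
  then obtain xs where xs: "xs \<in> XX" "\<And>y. y \<in> XX \<Longrightarrow> quad_form Q y \<le> quad_form Q xs"
    using continuous_attains_sup continuous_on_quad_form by metis
  \<comment> \<open>These are the directions in which \<open>X \<sigma>\<close> alone attains the
    maximum over all of \<open>XX\<close>, phrased without suprema to match
    \<open>closed_dominating_directions\<close>.\<close>
  define A where
    "A \<sigma> = {z. \<forall>y\<in>XX. \<exists>x\<in>X \<sigma>. z \<bullet> (transpose B *v y) \<le> z \<bullet> (transpose B *v x)}" for \<sigma>
  have "R \<subseteq> (\<Union>\<sigma>\<in>\<Sigma>R. A \<sigma>)"
  proof
    fix z assume "z \<in> R"
    then obtain \<sigma> where act: "regularly_active B \<Sigma> X R \<sigma>"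
        and \<sigma>: "h_struct B X \<sigma> z = h_max B \<Sigma> X z"
      using ex_regularly_active[OF assms(1,2)] by metis
    then have "\<sigma> \<in> \<Sigma>"
      by (simp add: regularly_active_def)
    \<comment> \<open>One maximizer for the direction \<open>z\<close> serves as the witness for
      every \<open>y\<close>.\<close>
    then obtain x where x: "x \<in> X \<sigma>" "h_struct B X \<sigma> z = z \<bullet> (transpose B *v x)"
      using h_struct_attained assms(3,4) by metis
    have "z \<bullet> (transpose B *v y) \<le> z \<bullet> (transpose B *v x)" if "y \<in> XX" for y
    proof -
      from that obtain \<tau> where "\<tau> \<in> \<Sigma>" "y \<in> X \<tau>"
        unfolding XX by blast
      with assms(1,4) show ?thesis
        using inner_le_h_max[of \<Sigma> \<tau> X y z B] \<sigma> x by simp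
    qed
    with x have "z \<in> A \<sigma>"
      unfolding A_def by blast
    with act \<open>\<sigma> \<in> \<Sigma>\<close> show "z \<in> (\<Union>\<sigma>\<in>\<Sigma>R. A \<sigma>)"
      unfolding \<Sigma>R by blast
  qed
  moreover have "closed (\<Union>\<sigma>\<in>\<Sigma>R. A \<sigma>)"
    unfolding A_def using finR subR assms(4)
    by (intro closed_UN ballI closed_dominating_directions) auto
  ultimately have "UNIV \<subseteq> (\<Union>\<sigma>\<in>\<Sigma>R. A \<sigma>)"
    using closure_minimal dense by metis
  \<comment> \<open>Membership in \<open>A \<sigma>\<close> is used for the direction
    \<open>transpose B *v xs\<close> and the competitor \<open>y = xs\<close>.\<close>
  then obtain \<sigma> x where \<sigma>: "\<sigma> \<in> \<Sigma>R" and x: "x \<in> X \<sigma>"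
      and "(transpose B *v xs) \<bullet> (transpose B *v xs) \<le> (transpose B *v xs) \<bullet> (transpose B *v x)"
    using xs(1) unfolding A_def by blast
  then have "norm (transpose B *v xs) \<le> norm (transpose B *v x)"
    by (intro norm_le_of_norm_sq_le_inner) (simp add: power2_norm_eq_inner)
  then have xs_le: "quad_form Q xs \<le> quad_form Q x"
    unfolding Q quad_form_Gram by (simp add: power_mono)
  have "x \<in> XX"
    using \<sigma> x subR unfolding XX by blast
  have "is_arg_max (quad_form Q) (\<lambda>x. x \<in> XX) x"
    unfolding is_arg_max_linorder using \<open>x \<in> XX\<close> xs(2) xs_le order_trans by blast
  moreover
  have "is_arg_max (quad_form Q) (\<lambda>x. x \<in> XX) (sol \<tau>)"
    if sol: "\<forall>\<sigma>\<in>\<Sigma>R. is_arg_max (quad_form Q) (\<lambda>x. x \<in> X \<sigma>) (sol \<sigma>)"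
      and \<tau>: "is_arg_max (\<lambda>\<sigma>. quad_form Q (sol \<sigma>)) (\<lambda>\<sigma>. \<sigma> \<in> \<Sigma>R) \<tau>" for sol \<tau>
  proof -
    \<comment> \<open>The structure \<open>\<sigma>\<close> containing \<open>x\<close> links the
      two levels: \<open>sol \<sigma>\<close> is at least as good as \<open>x\<close>, and
      \<open>sol \<tau>\<close> at least as good as \<open>sol \<sigma>\<close>.\<close>
    have "quad_form Q x \<le> quad_form Q (sol \<sigma>)" "quad_form Q (sol \<sigma>) \<le> quad_form Q (sol \<tau>)"
      using sol \<tau> \<sigma> x by (auto simp: is_arg_max_linorder)
    with xs_le have "quad_form Q xs \<le> quad_form Q (sol \<tau>)"
      by linarith
    moreover have "sol \<tau> \<in> XX"
      using sol \<tau> subR unfolding XX by (auto simp: is_arg_max_linorder)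
    ultimately show ?thesis
      using xs(2) unfolding is_arg_max_linorder by (meson order_trans)
  qed
  moreover have "\<exists>\<tau>. is_arg_max f (\<lambda>\<sigma>. \<sigma> \<in> \<Sigma>R) \<tau>" for f :: "'s \<Rightarrow> real"
  proof -
    \<comment> \<open>The structure \<open>\<sigma>\<close> found above shows that
      \<open>\<Sigma>R\<close> is nonempty.\<close>
    have "Max (f ` \<Sigma>R) \<in> f ` \<Sigma>R"
      using finR \<sigma> by (intro Max_in) auto
    then obtain \<tau> where "\<tau> \<in> \<Sigma>R" and "Max (f ` \<Sigma>R) = f \<tau>"
      by blast
    then show ?thesis
      using finR unfolding is_arg_max_linorder by (metis Max_ge finite_imageI imageI)
  qed
  ultimately show ?thesis
    using \<sigma> x by blast
qed

end
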